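(* Suppose that $\mu<\kappa$ are infinite cardinals and $2^\mu=2^\kappa$ (as cardinals). Then there is an almost $\Delta$-regressive colouring $c:[2^\kappa]^2\to\kappa$ with no monochromatic odd cycles.
   Context: $2^\kappa$ also denotes the set of all functions from $\kappa$ to $2=\{0,1\}$; $[X]^2$ is the set of two-element subsets of $X$, and $c(x,y)$ abbreviates $c(\{x,y\})$. For distinct $x,y\in 2^\kappa$, $\Delta(x,y)=\min\{i<\kappa: x(i)\neq y(i)\}$. A colouring $c:[2^\kappa]^2\to\kappa$ is almost $\Delta$-regressive if there is $\mu'<\kappa$ such that $c(x,y)<\max\{\Delta(x,y),\mu'\}$ for all $x\neq y$ in $2^\kappa$. A $c$-monochromatic odd cycle is an injective sequence $\langle x_i\mid i<k\rangle$ of elements of $2^\kappa$ with $k\geq 3$ odd such that $c$ is constant on $\{\{x_i,x_{i+1}\}\mid i+1<k\}\cup\{\{x_{k-1},x_0\}\}$. *)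

theory Defs
  imports Main "HOL-Library.Ramsey"
begin

unbundle cardinal_syntax

text \<open>
  An infinite cardinal is represented as in the cardinal theories of the library, by a relation
  \<open>\<kappa>\<close> with \<open>Cinfinite \<kappa>\<close>: the ordinals below the cardinal are the elements of
  \<open>Field \<kappa>\<close>, \<open>(i, j) \<in> \<kappa>\<close> means \<open>i \<le> j\<close>, and \<open>i \<in> underS \<kappa> j\<close> means \<open>i < j\<close>.
\<close>

text \<open>
  The members of \<open>Func A B\<close> take the value \<open>undefined\<close> outside \<open>A\<close>, so distinct members
  differ on \<open>A\<close>. By definition \<open>ctwo ^c \<kappa>\<close> is the cardinality of \<open>two_pow \<kappa>\<close>.
\<close>

abbreviation two_pow :: "'a rel \<Rightarrow> ('a \<Rightarrow> bool) set"
  where "two_pow \<kappa> \<equiv> Func (Field \<kappa>) UNIV"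

definition Delta :: "'a rel \<Rightarrow> ('a \<Rightarrow> bool) \<Rightarrow> ('a \<Rightarrow> bool) \<Rightarrow> 'a"
  where "Delta \<kappa> x y = wo_rel.minim \<kappa> {i \<in> Field \<kappa>. x i \<noteq> y i}"

definition almost_Delta_regressive :: "'a rel \<Rightarrow> (('a \<Rightarrow> bool) set \<Rightarrow> 'a) \<Rightarrow> bool"
  where "almost_Delta_regressive \<kappa> c \<longleftrightarrow>
    (\<exists>\<mu>' \<in> Field \<kappa>. \<forall>x \<in> two_pow \<kappa>. \<forall>y \<in> two_pow \<kappa>. x \<noteq> y \<longrightarrow>
       c {x, y} \<in> underS \<kappa> (wo_rel.max2 \<kappa> (Delta \<kappa> x y) \<mu>'))"

text \<open>The cycle \<open>\<langle>x i | i < k\<rangle>\<close>; values of \<open>x\<close> at arguments \<open>\<ge> k\<close> are irrelevant.\<close>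

definition monochromatic_odd_cycle ::
    "'a rel \<Rightarrow> (('a \<Rightarrow> bool) set \<Rightarrow> 'a) \<Rightarrow> nat \<Rightarrow> (nat \<Rightarrow> 'a \<Rightarrow> bool) \<Rightarrow> bool"
  where "monochromatic_odd_cycle \<kappa> c k x \<longleftrightarrow>
    3 \<le> k \<and> odd k \<and> x ` {..<k} \<subseteq> two_pow \<kappa> \<and> inj_on x {..<k} \<and>
    (\<exists>\<gamma>. \<forall>e \<in> {{x i, x (i + 1)} | i. i + 1 < k} \<union> {{x (k - 1), x 0}}. c e = \<gamma>)"

end

theory Submission
  imports Defs
begin

text \<open>
  An injection \<open>g\<close> of \<open>two_pow \<kappa>\<close> into \<open>two_pow \<mu>\<close> lets us colour \<open>{x, y}\<close> by a coordinate, taken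
  from \<open>\<mu>\<close>, at which \<open>g x\<close> and \<open>g y\<close> differ. Identifying \<open>\<mu>\<close> with an initial segment of \<open>\<kappa>\<close> makes
  all colours smaller than a fixed element of \<open>\<kappa>\<close>, and the \<open>i\<close>-th colour class is bipartite, the
  sides being given by the bit \<open>g x i\<close>.
\<close>

lemma alternating_bool:
  fixes b :: "nat \<Rightarrow> bool"
  assumes "\<And>i. i + 1 < k \<Longrightarrow> b i \<noteq> b (i + 1)" and "j < k"
  shows "b j = (b 0 \<longleftrightarrow> even j)"
  using \<open>j < k\<close>
proof (induction j)
  case (Suc j)
  then show ?case
    using assms(1)[of j] by auto
qed simp

text \<open>Along the path from \<open>x 0\<close> to \<open>x (k - 1)\<close> the side
  \<open>b\<close> alternates. As \<open>k - 1\<close> is even, both ends lie on the same side,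
  which the closing edge forbids.\<close>

lemma no_monochromatic_odd_cycle_if_bipartite:
  assumes "\<And>\<gamma>. \<exists>b :: ('a \<Rightarrow> bool) \<Rightarrow> bool. \<forall>x \<in> two_pow \<kappa>. \<forall>y \<in> two_pow \<kappa>.
             x \<noteq> y \<longrightarrow> c {x, y} = \<gamma> \<longrightarrow> b x \<noteq> b y"
  shows "\<not> monochromatic_odd_cycle \<kappa> c k x"
proof
  let ?E = "{{x i, x (i + 1)} | i. i + 1 < k} \<union> {{x (k - 1), x 0}}"
  assume "monochromatic_odd_cycle \<kappa> c k x"
  then have k: "3 \<le> k" "odd k" and sub: "x ` {..<k} \<subseteq> two_pow \<kappa>" and inj: "inj_on x {..<k}"
    and "\<exists>\<gamma>. \<forall>e \<in> ?E. c e = \<gamma>"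
    unfolding monochromatic_odd_cycle_def by simp_all
  then obtain \<gamma> where e: "\<forall>e \<in> ?E. c e = \<gamma>"
    by (elim exE)
  have x: "x i \<in> two_pow \<kappa>" if "i < k" for i
    using sub that by blast
  have step: "c {x i, x (i + 1)} = \<gamma>" if "i + 1 < k" for i
    using that by (intro bspec[OF e]) blast
  have last: "c {x (k - 1), x 0} = \<gamma>"
    by (intro bspec[OF e]) blast
  obtain b :: "('a \<Rightarrow> bool) \<Rightarrow> bool" where b: "b u \<noteq> b v"
    if "u \<in> two_pow \<kappa>" "v \<in> two_pow \<kappa>" "u \<noteq> v" "c {u, v} = \<gamma>" for u v
    using assms[of \<gamma>] by blast
  have "b (x i) \<noteq> b (x (i + 1))" if "i + 1 < k" for i
    using that b[OF x x _ step] inj_onD[OF inj, of i "i + 1"] by force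
  then have "b (x (k - 1)) = (b (x 0) \<longleftrightarrow> even (k - 1))"
    using k by (intro alternating_bool[of k "\<lambda>i. b (x i)"]) auto
  \<comment> \<open>The closing edge joins distinct points because \<open>3 \<le> k\<close> gives
    \<open>k - 1 \<noteq> 0\<close>.\<close>
  moreover have "b (x (k - 1)) \<noteq> b (x 0)"
    using k last inj_onD[OF inj, of "k - 1" 0] by (intro b x) auto
  ultimately show False
    using k by simp
qed

lemma Func_neqE:
  assumes "f \<in> Func A B" and "g \<in> Func A B" and "f \<noteq> g"
  obtains a where "a \<in> A" and "f a \<noteq> g a"
proof -
  obtain a where "f a \<noteq> g a"
    using assms(3) by blast
  moreover from this have "a \<in> A"
    using assms(1,2) by (cases "a \<in> A") (simp_all add: Func_def)
  ultimately show thesis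
    by (rule that[rotated])
qed

lemma Delta_in_Field:
  assumes "Well_order \<kappa>" "x \<in> two_pow \<kappa>" "y \<in> two_pow \<kappa>" "x \<noteq> y"
  shows "Delta \<kappa> x y \<in> Field \<kappa>"
proof -
  interpret wo_rel \<kappa>
    using assms(1) by (simp add: wo_rel_def)
  have "{i \<in> Field \<kappa>. x i \<noteq> y i} \<noteq> {}"
    using Func_neqE[OF assms(2-4)] by blast
  then show ?thesis
    unfolding Delta_def using minim_inField[of "{i \<in> Field \<kappa>. x i \<noteq> y i}"] by blast
qed

theorem proposition2p5:
  fixes \<kappa> :: "'a rel" and \<mu> :: "'b rel"
  assumes "Cinfinite \<kappa>" and "Cinfinite \<mu>" and "\<mu> <o \<kappa>"
    and "ctwo ^c \<mu> =o ctwo ^c \<kappa>"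
  shows "\<exists>c. c \<in> nsets (two_pow \<kappa>) 2 \<rightarrow> Field \<kappa> \<and>
           almost_Delta_regressive \<kappa> c \<and>
           (\<nexists>k x. monochromatic_odd_cycle \<kappa> c k x)"
proof -
  have wo: "Well_order \<kappa>" "Well_order \<mu>"
    using assms by (auto simp: card_order_on_well_order_on)
  have "wo_rel \<kappa>"
    using wo by (simp add: wo_rel_def)
  obtain f where f: "embedS \<mu> \<kappa> f"
    using assms(3) unfolding ordLess_def by blast
  then have emb: "embed \<mu> \<kappa> f" and "f ` Field \<mu> \<subset> Field \<kappa>"
    using embedS_Field[OF wo(2) f] unfolding embedS_def by auto
  \<comment> \<open>The range of an embedding is an initial segment. It is proper here, so it
    consists of the elements below some \<open>m\<close>, which later serves as the bound
    \<mu>'.\<close>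
  then obtain m where m: "m \<in> Field \<kappa>" and fm: "f ` Field \<mu> = underS \<kappa> m"
    using embed_Field_ofilter[OF wo(2,1) emb]
    unfolding wo_rel.ofilter_underS_Field[OF \<open>wo_rel \<kappa>\<close>] by blast
  have inj_f: "inj_on f (Field \<mu>)"
    using embed_inj_on[OF wo(2) emb] .
  obtain g where g: "bij_betw g (two_pow \<kappa>) (two_pow \<mu>)"
    using ordIso_symmetric[OF assms(4)] card_of_ordIso
    unfolding cexp_def ctwo_def Field_card_of by blast
  \<comment> \<open>Letting \<open>x\<close> and \<open>y\<close> both range over \<open>e\<close>
    makes the choice depend on the unordered pair only. The case \<open>x = y\<close> contributes no
    coordinate.\<close>
  define c where
    "c = (\<lambda>e. f (SOME i. i \<in> Field \<mu> \<and> (\<exists>x \<in> e. \<exists>y \<in> e. g x i \<noteq> g y i)))"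
  have c: "\<exists>i \<in> Field \<mu>. g x i \<noteq> g y i \<and> c {x, y} = f i"
    if "x \<in> two_pow \<kappa>" "y \<in> two_pow \<kappa>" "x \<noteq> y" for x y
  proof -
    have "g x \<in> two_pow \<mu>" "g y \<in> two_pow \<mu>" "g x \<noteq> g y"
      using that g by (auto simp: bij_betw_def inj_on_def)
    then obtain i where "i \<in> Field \<mu>" "g x i \<noteq> g y i"
      by (rule Func_neqE)
    then have "\<exists>i. i \<in> Field \<mu> \<and> (\<exists>u \<in> {x, y}. \<exists>v \<in> {x, y}. g u i \<noteq> g v i)"
      by blast
    from someI_ex[OF this] show ?thesis
      unfolding c_def by blast
  qed
  have c_under: "c {x, y} \<in> underS \<kappa> m"
    if "x \<in> two_pow \<kappa>" "y \<in> two_pow \<kappa>" "x \<noteq> y" for x y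
    using c[OF that] fm by blast
  have "c \<in> nsets (two_pow \<kappa>) 2 \<rightarrow> Field \<kappa>"
    using c_under underS_Field by (fastforce simp: nsets_2_eq)
  moreover have "almost_Delta_regressive \<kappa> c"
    unfolding almost_Delta_regressive_def
  proof (intro bexI[OF _ m] ballI impI)
    fix x y assume xy: "x \<in> two_pow \<kappa>" "y \<in> two_pow \<kappa>" "x \<noteq> y"
    \<comment> \<open>All colours lie below \<open>m\<close>, so it suffices that the maximum is at
      least \<open>m\<close>. Comparing the two needs \<open>Delta \<kappa> x y\<close> to lie in
      \<open>Field \<kappa>\<close>.\<close>
    have "(m, wo_rel.max2 \<kappa> (Delta \<kappa> x y) m) \<in> \<kappa>"
      using wo_rel.max2_greater[OF \<open>wo_rel \<kappa>\<close>] Delta_in_Field[OF wo(1) xy] m by simp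
    from underS_incr[OF wo_rel.TRANS[OF \<open>wo_rel \<kappa>\<close>] wo_rel.ANTISYM[OF \<open>wo_rel \<kappa>\<close>] this]
    show "c {x, y} \<in> underS \<kappa> (wo_rel.max2 \<kappa> (Delta \<kappa> x y) m)"
      using c_under[OF xy] by (rule subsetD)
  qed
  moreover have "\<not> monochromatic_odd_cycle \<kappa> c k x" for k x
  proof (rule no_monochromatic_odd_cycle_if_bipartite)
    fix \<gamma>
    show "\<exists>b :: ('a \<Rightarrow> bool) \<Rightarrow> bool. \<forall>x \<in> two_pow \<kappa>. \<forall>y \<in> two_pow \<kappa>.
      x \<noteq> y \<longrightarrow> c {x, y} = \<gamma> \<longrightarrow> b x \<noteq> b y"
      \<comment> \<open>An edge of colour \<gamma> has \<open>\<gamma> = f i\<close> for a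
        coordinate \<open>i\<close> that separates its ends, and injectivity of \<open>f\<close>
        recovers this \<open>i\<close> from \<gamma>. If \<gamma> is not in the range of
        \<open>f\<close>, no edge has this colour and the arbitrary value of \<open>inv_into\<close>
        is harmless.\<close>
      using c inj_f by (intro exI[of _ "\<lambda>x. g x (inv_into (Field \<mu>) f \<gamma>)"]) force
  qed
  ultimately show ?thesis
    by blast
qed

end
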